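(* Let $q\in(0,1)$, $s=1-q$, let $T_0$ be a positive-integer-valued, almost surely finite random variable with probability generating function $g$, let $T$ be its completion time under memoryless catastrophe with rate $q$, and put $p=g(s)$, $D_k=g^{(k)}(s)$, $\eta_k=E[T(T-1)\cdots(T-k+1)]$. For $k\ge2$, in the expression of $\eta_k$ in terms of $D_0=p,D_1,\dots,D_{k-1}$ given by the moment recursion, the total coefficient of $D_{k-1}$ is \[ -\frac{k\,s^{k-1}}{p^2q}\neq0, \] i.e. $\eta_k=-\frac{k s^{k-1}}{p^2q}D_{k-1}+R_k$ where $R_k$ is a function of $q$ and $D_0,\dots,D_{k-2}$ only; so $D_{k-1}$ makes a nonzero contribution to $\eta_k$ provided $D_{k-1}\ne0$. The condition $D_{k-1}\neq0$ holds whenever $P(T_0\ge k)>0$. In particular, for base times with unbounded support, every moment level $k\ge2$ introduces exactly one new derivative $D_{k-1}$ of $g$ (with $D_{k-1}\ne0$).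
   Context: $g(z)=E[z^{T_0}]$. Memoryless catastrophe with rate $q$: attempts $i=1,2,\dots$ are independent; attempt $i$ has a copy $T_0^{(i)}$ of $T_0$ and an independent $\tau_i$ with $P(\tau_i>t)=s^t$, $t=0,1,2,\dots$ (catastrophe occurs at each step independently with probability $q$); it succeeds iff $T_0^{(i)}<\tau_i$, and lasts $\min(T_0^{(i)},\tau_i)$ steps. $T$ is the total length of all attempts up to and including the first successful one. Moment recursion: with $D(w)=(1-w)+qw\,g(ws)$ and $N(w)=(1-ws)g(ws)$ one has $G_T=N/D$, $\eta_0=1$, and for $k\ge1$ \[ \eta_k=\frac1{pq}\Bigl(\Delta_k-\sum_{j=1}^{k-1}\binom kj D^{(j)}(1)\,\eta_{k-j}\Bigr),\qquad \Delta_k=N^{(k)}(1)-D^{(k)}(1), \] where $\Delta_1=1-p$ and $\Delta_k=-ks^{k-1}D_{k-1}$ for $k\ge2$. *)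

theory Defs
  imports "HOL-Probability.Probability" "HOL-Computational_Algebra.Formal_Power_Series"
begin

definition pgf :: "'a measure \<Rightarrow> ('a \<Rightarrow> nat) \<Rightarrow> real \<Rightarrow> real" where
  "pgf N T0 z = integral\<^sup>L N (\<lambda>\<omega>. z ^ T0 \<omega>)"

(* X i is the base time of attempt i and tau i its catastrophe time, i = 1, 2, ...
   On the null event that no attempt succeeds, LEAST is unspecified, and so is the value. *)
definition first_success :: "(nat \<Rightarrow> 'a \<Rightarrow> nat) \<Rightarrow> (nat \<Rightarrow> 'a \<Rightarrow> nat) \<Rightarrow> 'a \<Rightarrow> nat" where
  "first_success X tau \<omega> = (LEAST i. 1 \<le> i \<and> X i \<omega> < tau i \<omega>)"

definition completion_time :: "(nat \<Rightarrow> 'a \<Rightarrow> nat) \<Rightarrow> (nat \<Rightarrow> 'a \<Rightarrow> nat) \<Rightarrow> 'a \<Rightarrow> nat" where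
  "completion_time X tau \<omega> = (\<Sum>i = 1..first_success X tau \<omega>. min (X i \<omega>) (tau i \<omega>))"

definition falling_factorial :: "nat \<Rightarrow> nat \<Rightarrow> real" where
  "falling_factorial k n = (\<Prod>i<k. real n - real i)"

(* The moment recursion as an expression in indeterminate values d 0, d 1, ... for the
   derivatives g(s), g'(s), ... where s = 1 - q.  Series are expanded at w = 1, in u = w - 1:
   g(w s) = g(s + s u) becomes the sum of d j * s^j / j! * u^j, and the j-th derivative of a
   function at w = 1 is j! times the j-th coefficient of its series. *)
definition g_series :: "real \<Rightarrow> (nat \<Rightarrow> real) \<Rightarrow> real fps" where
  "g_series q d = Abs_fps (\<lambda>j. d j * (1 - q) ^ j / fact j)"

(* D(w) = (1 - w) + q w g(w s) *)
definition D_series :: "real \<Rightarrow> (nat \<Rightarrow> real) \<Rightarrow> real fps" where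
  "D_series q d = - fps_X + fps_const q * (1 + fps_X) * g_series q d"

(* N(w) = (1 - w s) g(w s) *)
definition N_series :: "real \<Rightarrow> (nat \<Rightarrow> real) \<Rightarrow> real fps" where
  "N_series q d = (1 - fps_const (1 - q) * (1 + fps_X)) * g_series q d"

definition deriv_at_1 :: "real fps \<Rightarrow> nat \<Rightarrow> real" where
  "deriv_at_1 F j = fact j * fps_nth F j"

definition Delta :: "real \<Rightarrow> (nat \<Rightarrow> real) \<Rightarrow> nat \<Rightarrow> real" where
  "Delta q d k = deriv_at_1 (N_series q d) k - deriv_at_1 (D_series q d) k"

fun eta_expr :: "real \<Rightarrow> (nat \<Rightarrow> real) \<Rightarrow> nat \<Rightarrow> real" where
  "eta_expr q d 0 = 1"
| "eta_expr q d (Suc n) =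
     1 / (d 0 * q) *
       (Delta q d (Suc n) -
        (\<Sum>j = 1..n. real (Suc n choose j) * deriv_at_1 (D_series q d) j * eta_expr q d (Suc n - j)))"

(* Indices i of the derivatives that the expression for the k-th factorial moment genuinely
   depends on; d 0 stands for p = g(s), by which the recursion divides, hence is kept nonzero. *)
definition derivs_in :: "real \<Rightarrow> nat \<Rightarrow> nat set" where
  "derivs_in q k = {i. \<exists>d x. d 0 \<noteq> 0 \<and> (d(i := x)) 0 \<noteq> 0 \<and>
                          eta_expr q (d(i := x)) k \<noteq> eta_expr q d k}"

lemma fact_Suc_cancel:
  "(fact (Suc n) :: real) * (a / fact (Suc n)) = a"
  "(fact (Suc n) :: real) * (b / fact n) = real (Suc n) * b"
  by (simp_all add: fact_nonzero del: fact_Suc) (simp add: fact_Suc)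

(* The closed forms that the j-th derivative of D(w) and the numbers Delta k take. *)
lemma deriv_at_1_D_series_Suc:
  "deriv_at_1 (D_series q d) (Suc n) =
     q * ((1 - q) ^ Suc n * d (Suc n) + real (Suc n) * (1 - q) ^ n * d n) - (if n = 0 then 1 else 0)"
proof -
  have "fps_nth (D_series q d) (Suc n) =
      q * (d (Suc n) * (1 - q) ^ Suc n / fact (Suc n) + d n * (1 - q) ^ n / fact n)
        - (if n = 0 then 1 else 0)"
    unfolding D_series_def g_series_def
    by (simp add: distrib_right mult.assoc fps_X_nth del: power_Suc fact_Suc)
  then have "deriv_at_1 (D_series q d) (Suc n) =
      q * (fact (Suc n) * (d (Suc n) * (1 - q) ^ Suc n / fact (Suc n))
           + fact (Suc n) * (d n * (1 - q) ^ n / fact n)) - (if n = 0 then 1 else 0)"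
    by (simp add: deriv_at_1_def right_diff_distrib distrib_left del: fact_Suc power_Suc)
  then show ?thesis
    unfolding fact_Suc_cancel by (simp add: algebra_simps)
qed

lemma deriv_at_1_N_series_Suc:
  "deriv_at_1 (N_series q d) (Suc n) =
     q * (1 - q) ^ Suc n * d (Suc n) - real (Suc n) * (1 - q) ^ Suc n * d n"
proof -
  have "N_series q d = fps_const q * g_series q d - fps_const (1 - q) * (fps_X * g_series q d)"
    by (simp add: N_series_def algebra_simps flip: fps_const_sub)
  then have "fps_nth (N_series q d) (Suc n) =
      q * (d (Suc n) * (1 - q) ^ Suc n / fact (Suc n)) - (1 - q) * (d n * (1 - q) ^ n / fact n)"
    by (simp add: g_series_def del: power_Suc fact_Suc)
  then have "deriv_at_1 (N_series q d) (Suc n) =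
      q * (fact (Suc n) * (d (Suc n) * (1 - q) ^ Suc n / fact (Suc n)))
      - (1 - q) * (fact (Suc n) * (d n * (1 - q) ^ n / fact n))"
    by (simp add: deriv_at_1_def right_diff_distrib del: fact_Suc power_Suc)
  then show ?thesis
    unfolding fact_Suc_cancel by (simp add: algebra_simps)
qed

lemma Delta_1: "Delta q d 1 = 1 - d 0"
  using deriv_at_1_N_series_Suc[of q d 0] deriv_at_1_D_series_Suc[of q d 0]
  by (simp add: Delta_def algebra_simps)

lemma Delta_ge_2:
  assumes "2 \<le> k"
  shows "Delta q d k = - real k * (1 - q) ^ (k - 1) * d (k - 1)"
proof -
  obtain n where "k = Suc n" "n \<noteq> 0"
    using assms by (cases k) auto
  then show ?thesis
    by (simp add: Delta_def deriv_at_1_N_series_Suc deriv_at_1_D_series_Suc algebra_simps)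
qed

end

theory Submission
  imports Defs "HOL-Complex_Analysis.Cauchy_Integral_Formula"
begin

text \<open>
  Put \<open>w = 1 + u\<close> with \<open>u \<ge> 0\<close> small. By independence of the attempts,
  \<open>E[w\<^sup>T; the first n attempts fail, the next one succeeds] = b\<^sup>n a\<close>, where
  \<open>a = E[w\<^sup>X; X < \<tau>] = g(ws)\<close> and \<open>b = E[w\<^sup>\<tau>; \<tau> \<le> X] = qw(1 - g(ws)) / (1 - ws)\<close>.
  Summing the geometric series gives \<open>E[w\<^sup>T] = N(w) / D(w) < \<infinity>\<close> for \<open>0 \<le> u < q p\<close>.
  Since \<open>w\<^sup>T = \<Sum>\<^sub>k (T choose k) u\<^sup>k\<close> has nonnegative terms, all factorial moments of \<open>T\<close>
  are finite and \<open>\<eta>\<^sub>k / k!\<close> are the coefficients of a power series in \<open>u\<close> which, multiplied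
  by that of \<open>D\<close>, gives that of \<open>N\<close>; comparing coefficients is the moment recursion.
  In the recursion \<open>D\<^sub>k\<^sub>-\<^sub>1\<close> enters linearly, through \<open>\<Delta>\<^sub>k\<close> and through the term \<open>j = k - 1\<close> of the sum.
\<close>

subsection \<open>Dependence of the moment recursion on its indeterminates\<close>

lemma D_series_cong:
  assumes "\<And>i. i \<le> j \<Longrightarrow> d i = d' i"
  shows "deriv_at_1 (D_series q d) j = deriv_at_1 (D_series q d') j"
  using assms by (cases j) (auto simp: deriv_at_1_D_series_Suc, auto simp: deriv_at_1_def D_series_def g_series_def)

lemma eta_expr_1: "eta_expr q d 1 = (1 - d 0) / (d 0 * q)"
  using Delta_1[of q d] by simp

text \<open>Both \<open>N(w)\<close> and \<open>D(w)\<close> contribute \<open>q s^k d k\<close> to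
  their k-th derivatives, so \<open>d k\<close> cancels in the difference. This is why level
  \<open>k\<close> stops at the derivative of order \<open>k - 1\<close>.\<close>

lemma Delta_cong:
  assumes "\<And>i. i < k \<Longrightarrow> d i = d' i" "0 < k"
  shows "Delta q d k = Delta q d' k"
proof (cases "k = 1")
  case True
  then show ?thesis using assms Delta_1[of q d] Delta_1[of q d'] by auto
next
  case False
  then show ?thesis using assms by (auto simp: Delta_ge_2)
qed

text \<open>Strong induction: in the sum, the derivative of \<open>D(w)\<close> has order
  \<open>j <= k - 1\<close> and sees only \<open>d 0, ..., d j\<close>, while the other factor has a
  lower level \<open>k - j\<close>.\<close>

lemma eta_expr_cong:
  assumes "\<And>i. i < k \<Longrightarrow> d i = d' i"
  shows "eta_expr q d k = eta_expr q d' k"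
  using assms
proof (induction k rule: less_induct)
  case (less k)
  show ?case
  proof (cases k)
    case (Suc n)
    have "deriv_at_1 (D_series q d) j * eta_expr q d (Suc n - j) =
          deriv_at_1 (D_series q d') j * eta_expr q d' (Suc n - j)" if "j \<in> {1..n}" for j
      using that less Suc D_series_cong[of j d d' q] less.IH[of "Suc n - j"] by auto
    then have "(\<Sum>j = 1..n. real (Suc n choose j) * deriv_at_1 (D_series q d) j * eta_expr q d (Suc n - j))
      = (\<Sum>j = 1..n. real (Suc n choose j) * deriv_at_1 (D_series q d') j * eta_expr q d' (Suc n - j))"
      by (intro sum.cong) (simp_all add: mult.assoc)
    then show ?thesis
      using less.prems Suc Delta_cong[of k d d' q] by simp
  qed simp
qed

text \<open>With \<open>s = 1 - q\<close> and \<open>p = d 0\<close>, the entry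
  \<open>d (k - 1)\<close> enters twice: through \<open>Delta\<close> with slope
  \<open>-k s^(k-1)\<close>, and through the summand \<open>j = k - 1\<close> with slope
  \<open>k q s^(k-1)\<close> times the first moment \<open>(1 - p) / (p q)\<close>. Subtracting the
  second from the first gives \<open>-k s^(k-1) / p\<close>, and the prefactor
  \<open>1 / (p q)\<close> does the rest.\<close>

lemma eta_expr_affine:
  assumes "q \<noteq> 0" "2 \<le> k" "d 0 \<noteq> 0" and eq: "\<And>i. i < k - 1 \<Longrightarrow> d i = d' i"
  shows "eta_expr q d k - eta_expr q d' k =
    - (real k * (1 - q) ^ (k - 1) / ((d 0)\<^sup>2 * q)) * (d (k - 1) - d' (k - 1))"
proof -
  obtain m where k: "k = Suc (Suc m)"
    using assms(2) by (metis One_nat_def Suc_1 Suc_le_D Suc_le_mono)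
  let ?t = "\<lambda>d j. real (k choose j) * deriv_at_1 (D_series q d) j * eta_expr q d (k - j)"
  let ?x = "d (k - 1) - d' (k - 1)"
  have d0: "d' 0 = d 0"
    using eq[of 0] k by simp
  \<comment> \<open>Here \<open>m = k - 2\<close>: the derivative of order \<open>j\<close> and the
    level \<open>k - j\<close> both look only at indices below \<open>k - 1\<close>, where the
    sequences agree.\<close>
  have lower: "?t d j = ?t d' j" if "j \<in> {1..m}" for j
  proof -
    have "deriv_at_1 (D_series q d) j = deriv_at_1 (D_series q d') j"
      using that eq k by (intro D_series_cong) auto
    moreover have "eta_expr q d (k - j) = eta_expr q d' (k - j)"
      using that eq k by (intro eta_expr_cong) auto
    ultimately show ?thesis by simp
  qed
  have split: "eta_expr q d k = 1 / (d 0 * q) * (Delta q d k - (sum (?t d) {1..m} + ?t d (k - 1)))" for d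
    unfolding k eta_expr.simps by (simp del: eta_expr.simps)
  \<comment> \<open>For \<open>j = k - 1\<close> the remaining level is 1, so the last factor is the
    explicit first moment.\<close>
  have top: "?t d (k - 1) = real k * deriv_at_1 (D_series q d) (k - 1) * ((1 - d 0) / (d 0 * q))" for d
    using eta_expr_1[of q d] by (simp add: k del: eta_expr.simps)
  \<comment> \<open>The part with index \<open>m\<close> cancels because the sequences agree there;
    so does the constant -1 that is present when \<open>m = 0\<close>.\<close>
  have "deriv_at_1 (D_series q d) (k - 1) - deriv_at_1 (D_series q d') (k - 1) = q * (1 - q) ^ (k - 1) * ?x"
    using k eq[of m] by (simp add: deriv_at_1_D_series_Suc algebra_simps)
  moreover have "real k * b * c - real k * b' * c = real k * (b - b') * c" for b b' c :: real
    by (simp add: algebra_simps)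
  ultimately have topdiff: "?t d (k - 1) - ?t d' (k - 1) = real k * (q * (1 - q) ^ (k - 1) * ?x) * ((1 - d 0) / (d 0 * q))"
    unfolding top d0 by presburger
  have "eta_expr q d k - eta_expr q d' k =
      1 / (d 0 * q) * ((Delta q d k - Delta q d' k) - (?t d (k - 1) - ?t d' (k - 1)))"
  proof -
    have "sum (?t d) {1..m} = sum (?t d') {1..m}"
      using lower by (intro sum.cong) auto
    then show ?thesis
      unfolding split[of d] split[of d'] d0 by (simp only: algebra_simps)
  qed
  also have "\<dots> = 1 / (d 0 * q) * (- real k * (1 - q) ^ (k - 1) * ?x
      - real k * (q * (1 - q) ^ (k - 1) * ?x) * ((1 - d 0) / (d 0 * q)))"
    unfolding topdiff Delta_ge_2[OF assms(2)] by (simp only: algebra_simps)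
  also have "\<dots> = - (real k * (1 - q) ^ (k - 1) / ((d 0)\<^sup>2 * q)) * ?x"
  proof -
    \<comment> \<open>In essence \<open>1 + (1 - a) / a = 1 / a\<close>.\<close>
    have "1 / (a * q) * (- c * r * x - c * (q * r * x) * ((1 - a) / (a * q))) = - (c * r / (a\<^sup>2 * q)) * x"
      if "a \<noteq> 0" for a c r x :: real
      using that assms(1) by (simp add: field_simps power2_eq_square)
    then show ?thesis
      using assms(3) by blast
  qed
  finally show ?thesis .
qed

section \<open>The derivatives that enter at each moment level\<close>

lemma derivs_in_subset: "derivs_in q k \<subseteq> {..<k}"
proof
  fix i
  assume "i \<in> derivs_in q k"
  then obtain d x where "eta_expr q (d(i := x)) k \<noteq> eta_expr q d k"
    by (auto simp: derivs_in_def)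
  then show "i \<in> {..<k}"
    using eta_expr_cong[of k "d(i := x)" d q] by (cases "i < k") auto
qed

lemma last_in_derivs_in:
  assumes "0 < q" "q < 1" "0 < k"
  shows "k - 1 \<in> derivs_in q k"
proof -
  \<comment> \<open>Changing one entry of the constant sequence 1 to 2 keeps \<open>d 0\<close>
    nonzero. For \<open>k = 1\<close> the changed entry is \<open>d 0\<close> itself, so the first
    moment is evaluated directly instead of using the slope.\<close>
  define d :: "nat \<Rightarrow> real" where "d = (\<lambda>_. 1)"
  have "eta_expr q (d(k - 1 := 2)) k \<noteq> eta_expr q d k"
  proof (cases "k = 1")
    case True
    then have "eta_expr q (d(k - 1 := 2)) k = - 1 / (2 * q)" "eta_expr q d k = 0"
      unfolding True eta_expr_1 by (simp_all add: d_def)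
    then show ?thesis
      using assms by simp
  next
    case False
    have "eta_expr q d k - eta_expr q (d(k - 1 := 2)) k =
        - (real k * (1 - q) ^ (k - 1) / ((d 0)\<^sup>2 * q)) * (d (k - 1) - (d(k - 1 := 2)) (k - 1))"
      using False assms by (intro eta_expr_affine) (auto simp: d_def)
    also have "\<dots> \<noteq> 0"
      using assms by (simp add: d_def)
    finally show ?thesis
      by (metis diff_self)
  qed
  moreover have "d 0 \<noteq> 0" "(d(k - 1 := 2)) 0 \<noteq> 0"
    by (simp_all add: d_def)
  ultimately show ?thesis
    unfolding derivs_in_def by blast
qed

text \<open>Every \<open>i < k - 1\<close> already occurs at level \<open>i + 1 < k\<close>, as the
  largest index of that level. Hence the earlier levels together cover exactly
  \<open>{..<k - 1}\<close>.\<close>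

lemma new_derivs_in:
  assumes "0 < q" "q < 1" "0 < k"
  shows "derivs_in q k - (\<Union>j<k. derivs_in q j) = {k - 1}"
proof -
  have "(\<Union>j<k. derivs_in q j) = {..<k - 1}"
  proof
    show "(\<Union>j<k. derivs_in q j) \<subseteq> {..<k - 1}"
      using derivs_in_subset[of q] by fastforce
    show "{..<k - 1} \<subseteq> (\<Union>j<k. derivs_in q j)"
    proof
      fix i assume "i \<in> {..<k - 1}"
      then have "Suc i < k" "i \<in> derivs_in q (Suc i)"
        using last_in_derivs_in[OF assms(1,2), of "Suc i"] by auto
      then show "i \<in> (\<Union>j<k. derivs_in q j)" by blast
    qed
  qed
  moreover have "{..<k} - {..<k - 1} = {k - 1}"
    using assms(3) by auto
  ultimately show ?thesis
    using derivs_in_subset[of q k] last_in_derivs_in[OF assms] by blast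
qed

text \<open>\<open>R\<close> is the expression itself, evaluated with every derivative from the \<open>(k - 1)\<close>-st on set to 0.\<close>
lemma eta_expr_remainder:
  assumes "2 \<le> k"
  obtains R :: "real \<Rightarrow> real list \<Rightarrow> real" where
    "\<And>q d. 0 < q \<Longrightarrow> q < 1 \<Longrightarrow> d 0 \<noteq> 0 \<Longrightarrow>
       eta_expr q d k = - (real k * (1 - q) ^ (k - 1) / ((d 0)\<^sup>2 * q)) * d (k - 1) + R q (map d [0..<k - 1])"
proof
  define R :: "real \<Rightarrow> real list \<Rightarrow> real" where
    "R q xs = eta_expr q (\<lambda>i. if i < length xs then xs ! i else 0) k" for q xs
  fix q :: real and d :: "nat \<Rightarrow> real"
  assume "0 < q" "q < 1" "d 0 \<noteq> 0"
  moreover define d' where "d' = (\<lambda>i. if i < k - 1 then d i else 0)"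
  ultimately have "eta_expr q d k - eta_expr q d' k =
    - (real k * (1 - q) ^ (k - 1) / ((d 0)\<^sup>2 * q)) * (d (k - 1) - d' (k - 1))"
    using assms by (intro eta_expr_affine) auto
  moreover have R_d': "(\<lambda>i. if i < length (map d [0..<k - 1]) then map d [0..<k - 1] ! i else 0) = d'"
    by (auto simp: d'_def)
  ultimately show "eta_expr q d k = - (real k * (1 - q) ^ (k - 1) / ((d 0)\<^sup>2 * q)) * d (k - 1)
      + R q (map d [0..<k - 1])"
    unfolding R_def R_d' by (simp add: d'_def)
qed

subsection \<open>Probability generating functions of natural-number valued variables\<close>

lemma (in prob_space) nn_integral_nat:
  fixes f :: "nat \<Rightarrow> ennreal"
  assumes [measurable]: "X \<in> measurable M (count_space UNIV)"
  shows "(\<integral>\<^sup>+\<omega>. f (X \<omega>) \<partial>M) = (\<Sum>n. f n * ennreal (prob {\<omega> \<in> space M. X \<omega> = n}))"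
proof -
  have "(\<integral>\<^sup>+\<omega>. f (X \<omega>) \<partial>M) = (\<integral>\<^sup>+\<omega>. (\<Sum>n. f n * indicator {\<omega> \<in> space M. X \<omega> = n} \<omega>) \<partial>M)"
  proof (rule nn_integral_cong)
    fix \<omega> assume "\<omega> \<in> space M"
    then have "(\<lambda>n. f n * indicator {\<omega> \<in> space M. X \<omega> = n} \<omega>) = (\<lambda>n. if n = X \<omega> then f n else 0)"
      by (auto simp: indicator_def)
    then show "f (X \<omega>) = (\<Sum>n. f n * indicator {\<omega> \<in> space M. X \<omega> = n} \<omega>)"
      using sums_single[of "X \<omega>" f] by (simp add: sums_iff)
  qed
  also have "\<dots> = (\<Sum>n. \<integral>\<^sup>+\<omega>. f n * indicator {\<omega> \<in> space M. X \<omega> = n} \<omega> \<partial>M)"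
    by (intro nn_integral_suminf) auto
  also have "\<dots> = (\<Sum>n. f n * ennreal (prob {\<omega> \<in> space M. X \<omega> = n}))"
    by (simp add: nn_integral_cmult_indicator emeasure_eq_measure)
  finally show ?thesis .
qed

lemma (in prob_space) nn_integral_pgf:
  assumes [measurable]: "X \<in> measurable M (count_space UNIV)" and "0 \<le> z" "z \<le> 1"
  shows "(\<integral>\<^sup>+\<omega>. ennreal (z ^ X \<omega>) \<partial>M) = ennreal (pgf M X z)"
  unfolding pgf_def using assms
  by (intro nn_integral_eq_integral integrable_const_bound[where B = 1]) (auto simp: power_le_one)

lemma (in prob_space) pgf_nonneg: "0 \<le> z \<Longrightarrow> 0 \<le> pgf M X z"
  unfolding pgf_def by (intro integral_nonneg_AE) auto

lemma (in prob_space) pgf_sums: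
  assumes X: "X \<in> measurable M (count_space UNIV)" and "0 \<le> z" "z \<le> 1"
  shows "(\<lambda>n. prob {\<omega> \<in> space M. X \<omega> = n} * z ^ n) sums pgf M X z"
proof -
  have "(\<Sum>n. ennreal (z ^ n) * ennreal (prob {\<omega> \<in> space M. X \<omega> = n})) = ennreal (pgf M X z)"
    using nn_integral_nat[OF X, of "\<lambda>n. ennreal (z ^ n)"] nn_integral_pgf[OF assms] by simp
  then have "(\<lambda>n. ennreal (z ^ n) * ennreal (prob {\<omega> \<in> space M. X \<omega> = n})) sums ennreal (pgf M X z)"
    by (simp add: sums_iff)
  then have "(\<lambda>n. ennreal (prob {\<omega> \<in> space M. X \<omega> = n} * z ^ n)) sums ennreal (pgf M X z)"
    using assms by (simp add: ennreal_mult mult.commute)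
  then show ?thesis
    using assms by (subst (asm) sums_ennreal) (auto simp: pgf_nonneg)
qed

section \<open>Derivatives and Taylor expansion of a generating function at a point of (0,
  1)\<close>

lemma funpow_diffs: "(diffs ^^ j) c n = fact (n + j) / fact n * (c (n + j) :: real)"
proof (induction j arbitrary: n)
  case (Suc j)
  have "(fact (n + Suc j) :: real) / fact n = real (Suc n) * (fact (Suc n + j) / fact (Suc n))"
    by (simp add: divide_simps)
  then show ?case
    using Suc.IH[of "Suc n"] by (simp add: diffs_def)
qed simp

lemma (in prob_space) funpow_deriv_pgf:
  assumes X: "X \<in> measurable M (count_space UNIV)" and "0 < z" "z < 1"
  defines "c \<equiv> \<lambda>n. prob {\<omega> \<in> space M. X \<omega> = n}"
  shows "(\<lambda>n. (diffs ^^ j) c n * z ^ n) sums (deriv ^^ j) (pgf M X) z"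
proof -
  have summable: "summable (\<lambda>n. (diffs ^^ j) c n * x ^ n)" if "norm x < 1" for j and x :: real
    using that
  proof (induction j arbitrary: x)
    case 0
    \<comment> \<open>The point masses have a convergent sum, so the series converges at 1 and hence
      on the open unit disc.\<close>
    have "summable (\<lambda>n. c n * 1 ^ n)"
      using pgf_sums[OF X, of 1] by (simp add: c_def sums_iff)
    then show ?case
      using 0 powser_inside[of c 1 x] by simp
  next
    case (Suc j)
    then show ?case
      using termdiff_converges[of x 1 "(diffs ^^ j) c"] by simp
  qed
  have "(deriv ^^ j) (pgf M X) z = (\<Sum>n. (diffs ^^ j) c n * z ^ n)" if "0 < z" "z < 1" for z
    using that
  proof (induction j arbitrary: z)
    case 0
    then show ?case
      using pgf_sums[OF X, of z] by (simp add: c_def sums_iff)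
  next
    case (Suc j)
    have "((\<lambda>x. \<Sum>n. (diffs ^^ j) c n * x ^ n) has_field_derivative (\<Sum>n. diffs ((diffs ^^ j) c) n * z ^ n)) (at z)"
      using Suc.prems summable by (intro termdiffs_strong'[where K = 1]) auto
    \<comment> \<open>The induction hypothesis gives the formula only on (0, 1); as an open
      neighbourhood of \<open>z\<close> this suffices to transfer the derivative.\<close>
    then have "((deriv ^^ j) (pgf M X) has_field_derivative (\<Sum>n. diffs ((diffs ^^ j) c) n * z ^ n)) (at z)"
      using Suc by (subst has_field_derivative_cong_eventually[OF eventually_mono[OF eventually_at_in_open[of "{0<..<1}" z]]]) 
        (auto dest!: DERIV_imp_deriv)
    then show ?case
      using Suc.prems by (simp add: DERIV_imp_deriv)
  qed
  then show ?thesis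
    using summable[of z] assms by (simp add: sums_iff)
qed

text \<open>The j-th derivative of \<open>z^n\<close>, times \<open>z^j / j!\<close>, is
  \<open>(n choose j) z^n\<close>. Summing against the law of \<open>X\<close> turns derivatives of
  the generating function into integrals of nonnegative functions.\<close>

lemma (in prob_space) nn_integral_binomial_pgf:
  assumes X: "X \<in> measurable M (count_space UNIV)" and z: "0 < z" "z < 1"
  shows "(\<integral>\<^sup>+\<omega>. ennreal (z ^ X \<omega> * real (X \<omega> choose j)) \<partial>M) = ennreal ((deriv ^^ j) (pgf M X) z * z ^ j / fact j)"
    and "0 \<le> (deriv ^^ j) (pgf M X) z"
proof -
  define c where "c = (\<lambda>n. prob {\<omega> \<in> space M. X \<omega> = n})"
  have sums: "(\<lambda>n. (diffs ^^ j) c n * z ^ n) sums (deriv ^^ j) (pgf M X) z"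
    unfolding c_def by (rule funpow_deriv_pgf[OF assms])
  have "0 \<le> c n" for n
    by (simp add: c_def)
  then show nonneg: "0 \<le> (deriv ^^ j) (pgf M X) z"
    using sums_le[OF _ sums_zero sums] z by (auto simp: funpow_diffs)
  have "(\<lambda>n. (diffs ^^ j) c n * z ^ n * (z ^ j / fact j)) sums ((deriv ^^ j) (pgf M X) z * (z ^ j / fact j))"
    by (rule sums_mult2[OF sums])
  also have "(\<lambda>n. (diffs ^^ j) c n * z ^ n * (z ^ j / fact j)) = (\<lambda>n. z ^ (n + j) * real (n + j choose j) * c (n + j))"
    by (auto simp: funpow_diffs binomial_fact power_add mult_ac)
  \<comment> \<open>The shift by \<open>j\<close> can be undone because \<open>n choose j\<close>
    vanishes for \<open>n < j\<close>.\<close>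
  finally have "(\<lambda>n. z ^ n * real (n choose j) * c n) sums ((deriv ^^ j) (pgf M X) z * (z ^ j / fact j))"
    by (subst (asm) sums_iff_shift) (simp add: binomial_eq_0)
  then have "(\<lambda>n. ennreal (z ^ n * real (n choose j) * c n)) sums ennreal ((deriv ^^ j) (pgf M X) z * z ^ j / fact j)"
    using nonneg z \<open>\<And>n. 0 \<le> c n\<close> by (subst sums_ennreal) auto
  then show "(\<integral>\<^sup>+\<omega>. ennreal (z ^ X \<omega> * real (X \<omega> choose j)) \<partial>M) = ennreal ((deriv ^^ j) (pgf M X) z * z ^ j / fact j)"
    using z unfolding nn_integral_nat[OF X, of "\<lambda>n. ennreal (z ^ n * real (n choose j))"]
    by (simp add: sums_iff c_def ennreal_mult[symmetric])
qed

text \<open>Otherwise the nonnegative variable \<open>z^X (X choose j)\<close> would have integral 0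
  and vanish almost surely, but it is positive wherever \<open>j <= X\<close>.\<close>

lemma (in prob_space) funpow_deriv_pgf_pos:
  assumes [measurable]: "X \<in> measurable M (count_space UNIV)" and z: "0 < z" "z < 1"
    and pos: "0 < prob {\<omega> \<in> space M. j \<le> X \<omega>}"
  shows "0 < (deriv ^^ j) (pgf M X) z"
proof (rule ccontr)
  assume "\<not> ?thesis"
  then have "(deriv ^^ j) (pgf M X) z = 0"
    using nn_integral_binomial_pgf(2)[OF assms(1) z, of j] by simp
  then have "(\<integral>\<^sup>+\<omega>. ennreal (z ^ X \<omega> * real (X \<omega> choose j)) \<partial>M) = 0"
    using nn_integral_binomial_pgf(1)[OF assms(1) z, of j] by simp
  then have "AE \<omega> in M. ennreal (z ^ X \<omega> * real (X \<omega> choose j)) = 0"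
    by (subst (asm) nn_integral_0_iff_AE) auto
  then have "AE \<omega> in M. \<not> j \<le> X \<omega>"
  proof (rule AE_mp, intro AE_I2 impI notI)
    fix \<omega> assume "ennreal (z ^ X \<omega> * real (X \<omega> choose j)) = 0" "j \<le> X \<omega>"
    moreover have "0 < z ^ X \<omega> * real (X \<omega> choose j)"
      using z \<open>j \<le> X \<omega>\<close> by (intro mult_pos_pos) auto
    ultimately show False
      by (simp add: ennreal_eq_0_iff)
  qed
  then have "prob {\<omega> \<in> space M. j \<le> X \<omega>} = 0"
    by (subst prob_eq_0) auto
  then show False
    using pos by simp
qed

text \<open>Binomial theorem, then exchange of sum and integral; all terms are nonnegative, so
  infinite values are allowed. The weight \<open>f = z^X\<close> yields the Taylor expansion of
  \<open>g\<close>, and \<open>f = 1\<close> applied to \<open>T\<close> yields its factorial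
  moments.\<close>

lemma nn_integral_power_binomial:
  fixes f :: "'a \<Rightarrow> real"
  assumes [measurable]: "X \<in> measurable M (count_space UNIV)" "f \<in> borel_measurable M"
    and "\<And>\<omega>. 0 \<le> f \<omega>" "0 \<le> u"
  shows "(\<integral>\<^sup>+\<omega>. ennreal (f \<omega> * (1 + u) ^ X \<omega>) \<partial>M) =
    (\<Sum>j. (\<integral>\<^sup>+\<omega>. ennreal (f \<omega> * real (X \<omega> choose j)) \<partial>M) * ennreal (u ^ j))"
proof -
  have "(\<integral>\<^sup>+\<omega>. ennreal (f \<omega> * (1 + u) ^ X \<omega>) \<partial>M) =
      (\<integral>\<^sup>+\<omega>. (\<Sum>j. ennreal (f \<omega> * real (X \<omega> choose j)) * ennreal (u ^ j)) \<partial>M)"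
  proof (rule nn_integral_cong)
    fix \<omega>
    have "(1 + u) ^ X \<omega> = (\<Sum>j\<le>X \<omega>. real (X \<omega> choose j) * u ^ j)"
      using binomial_ring[of u 1 "X \<omega>"] by (simp add: add.commute)
    moreover have "(\<lambda>j. f \<omega> * (real (X \<omega> choose j) * u ^ j)) sums
        (\<Sum>j\<le>X \<omega>. f \<omega> * (real (X \<omega> choose j) * u ^ j))"
      by (rule sums_finite) (auto simp: not_le binomial_eq_0)
    ultimately have "(\<lambda>j. f \<omega> * (real (X \<omega> choose j) * u ^ j)) sums (f \<omega> * (1 + u) ^ X \<omega>)"
      by (simp add: sum_distrib_left)
    then have "(\<lambda>j. ennreal (f \<omega> * (real (X \<omega> choose j) * u ^ j))) sums ennreal (f \<omega> * (1 + u) ^ X \<omega>)"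
      using assms by (subst sums_ennreal) auto
    moreover have "ennreal (f \<omega> * real (X \<omega> choose j)) * ennreal (u ^ j) = ennreal (f \<omega> * (real (X \<omega> choose j) * u ^ j))" for j
      using assms(3,4) by (subst ennreal_mult[symmetric]) (auto simp: mult.assoc)
    ultimately show "ennreal (f \<omega> * (1 + u) ^ X \<omega>) = (\<Sum>j. ennreal (f \<omega> * real (X \<omega> choose j)) * ennreal (u ^ j))"
      by (simp add: sums_iff)
  qed
  also have "\<dots> = (\<Sum>j. \<integral>\<^sup>+\<omega>. ennreal (f \<omega> * real (X \<omega> choose j)) * ennreal (u ^ j) \<partial>M)"
    by (intro nn_integral_suminf) measurable
  also have "\<dots> = (\<Sum>j. (\<integral>\<^sup>+\<omega>. ennreal (f \<omega> * real (X \<omega> choose j)) \<partial>M) * ennreal (u ^ j))"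
    by (intro suminf_cong nn_integral_multc) measurable
  finally show ?thesis .
qed

text \<open>Comes from expanding the expectation of \<open>z^X (1 + u)^X\<close> in two ways rather
  than from analyticity.\<close>

lemma (in prob_space) pgf_taylor_sums:
  assumes X: "X \<in> measurable M (count_space UNIV)" and "0 < z" "0 \<le> u" "z * (1 + u) < 1"
  shows "(\<lambda>j. (deriv ^^ j) (pgf M X) z * z ^ j / fact j * u ^ j) sums pgf M X (z * (1 + u))"
proof -
  have z: "0 < z" "z < 1"
    using assms by (auto intro: le_less_trans[OF mult_left_mono[of 1 "1 + u" z, simplified]])
  have coeff_nonneg: "0 \<le> (deriv ^^ j) (pgf M X) z * z ^ j / fact j" for j
    using nn_integral_binomial_pgf(2)[OF X z] z by simp
  then have nonneg: "0 \<le> (deriv ^^ j) (pgf M X) z * z ^ j / fact j * u ^ j" for j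
    using assms(3) by (intro mult_nonneg_nonneg) auto
  have "(\<integral>\<^sup>+\<omega>. ennreal (z ^ X \<omega> * (1 + u) ^ X \<omega>) \<partial>M) = ennreal (pgf M X (z * (1 + u)))"
    using nn_integral_pgf[OF X, of "z * (1 + u)"] assms by (simp add: power_mult_distrib)
  moreover have "(\<integral>\<^sup>+\<omega>. ennreal (z ^ X \<omega> * (1 + u) ^ X \<omega>) \<partial>M) =
    (\<Sum>j. (\<integral>\<^sup>+\<omega>. ennreal (z ^ X \<omega> * real (X \<omega> choose j)) \<partial>M) * ennreal (u ^ j))"
    using X assms by (intro nn_integral_power_binomial) auto
  ultimately have "(\<Sum>j. ennreal ((deriv ^^ j) (pgf M X) z * z ^ j / fact j * u ^ j)) = ennreal (pgf M X (z * (1 + u)))"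
    using assms(3) unfolding nn_integral_binomial_pgf(1)[OF X z]
    by (simp only: ennreal_mult[OF coeff_nonneg zero_le_power])
  then have "(\<lambda>j. ennreal ((deriv ^^ j) (pgf M X) z * z ^ j / fact j * u ^ j)) sums ennreal (pgf M X (z * (1 + u)))"
    by (simp add: sums_iff)
  then show ?thesis
    using assms by (subst (asm) sums_ennreal[OF nonneg]) (auto intro: pgf_nonneg)
qed

subsection \<open>A single attempt and the completion time\<close>

text \<open>Fubini for the product of the two laws; it allows \<open>tau\<close> to be integrated
  first with the base time frozen.\<close>

lemma (in prob_space) nn_integral_indep_pair:
  fixes f :: "nat \<Rightarrow> nat \<Rightarrow> ennreal"
  assumes "indep_var (count_space UNIV) X (count_space UNIV) Y"
  shows "(\<integral>\<^sup>+\<omega>. f (X \<omega>) (Y \<omega>) \<partial>M) = (\<integral>\<^sup>+\<omega>. (\<integral>\<^sup>+\<omega>'. f (X \<omega>) (Y \<omega>') \<partial>M) \<partial>M)"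
proof -
  let ?C = "count_space UNIV :: nat measure"
  have [measurable]: "X \<in> measurable M ?C" "Y \<in> measurable M ?C"
    and eq: "distr M ?C X \<Otimes>\<^sub>M distr M ?C Y = distr M (?C \<Otimes>\<^sub>M ?C) (\<lambda>x. (X x, Y x))"
    using assms unfolding indep_var_distribution_eq by auto
  interpret Y: prob_space "distr M ?C Y"
    by (rule prob_space_distr) measurable
  have [measurable]: "case_prod f \<in> borel_measurable (?C \<Otimes>\<^sub>M ?C)"
    by (simp add: pair_measure_countable)
  have "(\<integral>\<^sup>+\<omega>. f (X \<omega>) (Y \<omega>) \<partial>M) = (\<integral>\<^sup>+z. case_prod f z \<partial>distr M (?C \<Otimes>\<^sub>M ?C) (\<lambda>x. (X x, Y x)))"
    by (subst nn_integral_distr) auto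
  also have "\<dots> = (\<integral>\<^sup>+x. (\<integral>\<^sup>+y. f x y \<partial>distr M ?C Y) \<partial>distr M ?C X)"
    unfolding eq[symmetric] by (subst Y.nn_integral_fst[symmetric]) (simp_all cong: measurable_cong_sets)
  also have "\<dots> = (\<integral>\<^sup>+\<omega>. (\<integral>\<^sup>+\<omega>'. f (X \<omega>) (Y \<omega>') \<partial>M) \<partial>M)"
    by (simp add: nn_integral_distr)
  finally show ?thesis .
qed

text \<open>As \<open>nat\<close> is countable, it is enough to fix the value of
  \<open>first_success\<close>, and in the partial sums that of the preceding sum.\<close>

lemma measurable_completion_time:
  assumes pair: "\<And>i. 1 \<le> i \<Longrightarrow> (\<lambda>\<omega>. (X i \<omega>, tau i \<omega>)) \<in> measurable M (count_space UNIV)"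
  shows "completion_time X tau \<in> measurable M (count_space UNIV)"
proof -
  have success: "(\<lambda>\<omega>. 1 \<le> i \<and> X i \<omega> < tau i \<omega>) \<in> measurable M (count_space UNIV)" for i
    using measurable_compose[OF pair[of i], of "\<lambda>(x, t). x < t" "count_space UNIV"] by (cases "1 \<le> i") auto
  have "first_success X tau \<in> measurable M (count_space UNIV)"
    unfolding first_success_def[abs_def] by (intro measurable_Least success)
  moreover have "(\<lambda>\<omega>. \<Sum>i = 1..n. min (X i \<omega>) (tau i \<omega>)) \<in> measurable M (count_space UNIV)" for n
  proof (induction n)
    case (Suc n)
    have "(\<lambda>\<omega>. m + min (X (Suc n) \<omega>) (tau (Suc n) \<omega>)) \<in> measurable M (count_space UNIV)" for m
      using measurable_compose[OF pair[of "Suc n"], of "\<lambda>(x, t). m + min x t" "count_space UNIV"] by simp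
    then have "(\<lambda>\<omega>. (\<Sum>i = 1..n. min (X i \<omega>) (tau i \<omega>)) + min (X (Suc n) \<omega>) (tau (Suc n) \<omega>)) \<in> measurable M (count_space UNIV)"
      using Suc by (rule measurable_compose_countable)
    then show ?case
      by simp
  qed simp
  ultimately show ?thesis
    unfolding completion_time_def[abs_def] by (rule measurable_compose_countable[rotated])
qed

lemma first_success_eqI:
  assumes "\<And>i. 1 \<le> i \<Longrightarrow> i \<le> n \<Longrightarrow> tau i \<omega> \<le> X i \<omega>" "X (Suc n) \<omega> < tau (Suc n) \<omega>"
  shows "first_success X tau \<omega> = Suc n"
  unfolding first_success_def
proof (rule Least_equality)
  fix i assume "1 \<le> i \<and> X i \<omega> < tau i \<omega>"
  then show "Suc n \<le> i"
    using assms(1)[of i] by linarith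
qed (use assms(2) in simp)

text \<open>If the first \<open>n\<close> attempts fail and the next succeeds, \<open>w^T\<close> is
  a product with one factor per attempt, so independence gives \<open>b^n a\<close>. The integrand
  is 0 where no attempt succeeds, since \<open>T\<close> is unspecified there.\<close>

lemma (in prob_space) nn_integral_completion_time:
  fixes w :: real
  assumes indep: "indep_vars (\<lambda>_. count_space UNIV) (\<lambda>i \<omega>. (X i \<omega>, tau i \<omega>)) {1..}"
    and w: "0 \<le> w"
    and success: "\<And>i. 1 \<le> i \<Longrightarrow> (\<integral>\<^sup>+\<omega>. (if X i \<omega> < tau i \<omega> then ennreal (w ^ X i \<omega>) else 0) \<partial>M) = a"
    and failure: "\<And>i. 1 \<le> i \<Longrightarrow> (\<integral>\<^sup>+\<omega>. (if X i \<omega> < tau i \<omega> then 0 else ennreal (w ^ tau i \<omega>)) \<partial>M) = b"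
  shows "(\<integral>\<^sup>+\<omega>. (if \<exists>i\<ge>1. X i \<omega> < tau i \<omega> then ennreal (w ^ completion_time X tau \<omega>) else 0) \<partial>M) = (\<Sum>n. b ^ n * a)"
proof -
  \<comment> \<open>\<open>h n i\<close> is the factor of attempt \<open>i\<close> in the scenario
    "attempts 1 to \<open>n\<close> fail, attempt \<open>n + 1\<close> succeeds": \<open>w\<close>
    to the length of the attempt if it behaves so, and 0 otherwise.\<close>
  define h :: "nat \<Rightarrow> nat \<Rightarrow> nat \<times> nat \<Rightarrow> ennreal" where
    "h = (\<lambda>n i (x, t). if i \<le> n then (if x < t then 0 else ennreal (w ^ t)) else (if x < t then ennreal (w ^ x) else 0))"
  let ?F = "\<lambda>n \<omega>. \<Prod>i\<in>{1..Suc n}. h n i (X i \<omega>, tau i \<omega>)"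
  have indep_h: "indep_vars (\<lambda>_. borel) (\<lambda>i \<omega>. h n i (X i \<omega>, tau i \<omega>)) {1..Suc n}" for n
    by (rule indep_vars_compose2[OF indep_vars_subset[OF indep]]) auto
  then have meas[measurable]: "?F n \<in> borel_measurable M" for n
    by (intro borel_measurable_prod_ennreal) (auto simp: indep_vars_def)
  have int: "(\<integral>\<^sup>+\<omega>. ?F n \<omega> \<partial>M) = b ^ n * a" for n
  proof -
    have "(\<integral>\<^sup>+\<omega>. ?F n \<omega> \<partial>M) = (\<Prod>i\<in>{1..Suc n}. \<integral>\<^sup>+\<omega>. h n i (X i \<omega>, tau i \<omega>) \<partial>M)"
      by (rule indep_vars_nn_integral[OF _ indep_h]) auto
    also have "\<dots> = (\<Prod>i\<in>{1..Suc n}. if i \<le> n then b else a)"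
      by (intro prod.cong) (auto simp: h_def success failure)
    also have "\<dots> = b ^ n * a"
      by simp
    finally show ?thesis .
  qed
  have pointwise: "(if \<exists>i\<ge>1. X i \<omega> < tau i \<omega> then ennreal (w ^ completion_time X tau \<omega>) else 0) = (\<Sum>n. ?F n \<omega>)" for \<omega>
  proof (cases "\<exists>i\<ge>1. X i \<omega> < tau i \<omega>")
    case False
    then have "?F n \<omega> = 0" for n
      by (simp add: h_def)
    then show ?thesis
      unfolding if_not_P[OF False] by (simp only: suminf_zero)
  next
    case True
    define m where "m = (LEAST n. X (Suc n) \<omega> < tau (Suc n) \<omega>)"
    have "\<exists>n. X (Suc n) \<omega> < tau (Suc n) \<omega>"
      using True by (metis One_nat_def Suc_le_D)
    then have m: "X (Suc m) \<omega> < tau (Suc m) \<omega>"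
      unfolding m_def by (rule LeastI_ex)
    have least: "tau (Suc n) \<omega> \<le> X (Suc n) \<omega>" if "n < m" for n
      using that not_less_Least[of n "\<lambda>n. X (Suc n) \<omega> < tau (Suc n) \<omega>"] by (simp add: m_def)
    have before: "tau i \<omega> \<le> X i \<omega>" if "1 \<le> i" "i \<le> m" for i
      using that least[of "i - 1"] by simp
    then have T: "completion_time X tau \<omega> = (\<Sum>i = 1..Suc m. min (X i \<omega>) (tau i \<omega>))"
      unfolding completion_time_def using first_success_eqI[of m tau \<omega> X] m by simp
    have "?F m \<omega> = (\<Prod>i\<in>{1..Suc m}. ennreal (w ^ min (X i \<omega>) (tau i \<omega>)))"
    proof (intro prod.cong refl)
      fix i assume "i \<in> {1..Suc m}"
      then consider "1 \<le> i" "i \<le> m" | "i = Suc m"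
        by fastforce
      then show "h m i (X i \<omega>, tau i \<omega>) = ennreal (w ^ min (X i \<omega>) (tau i \<omega>))"
        using before[of i] m by cases (simp_all add: h_def)
    qed
    also have "\<dots> = ennreal (w ^ completion_time X tau \<omega>)"
      unfolding T power_sum using w by (intro prod_ennreal) simp
    finally have Fm: "?F m \<omega> = ennreal (w ^ completion_time X tau \<omega>)" .
    \<comment> \<open>For \<open>n < m\<close> attempt \<open>n + 1\<close> would have to succeed,
      for \<open>n > m\<close> attempt \<open>m + 1\<close> would have to fail; either way one
      factor is 0.\<close>
    have "?F n \<omega> = 0" if "n \<noteq> m" for n
    proof (cases "n < m")
      case True
      then have "h n (Suc n) (X (Suc n) \<omega>, tau (Suc n) \<omega>) = 0"
        using least[of n] by (simp add: h_def)
      then show ?thesis by simp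
    next
      case False
      then have "h n (Suc m) (X (Suc m) \<omega>, tau (Suc m) \<omega>) = 0"
        using m that by (simp add: h_def)
      then show ?thesis
        using False that by (intro prod_zero) (auto intro!: bexI[of _ "Suc m"])
    qed
    then have "(\<Sum>n. ?F n \<omega>) = ?F m \<omega>"
      using suminf_finite[of "{m}" "\<lambda>n. ?F n \<omega>"] by simp
    then show ?thesis
      using True Fm by simp
  qed
  have "(\<integral>\<^sup>+\<omega>. (if \<exists>i\<ge>1. X i \<omega> < tau i \<omega> then ennreal (w ^ completion_time X tau \<omega>) else 0) \<partial>M)
      = (\<integral>\<^sup>+\<omega>. (\<Sum>n. ?F n \<omega>) \<partial>M)"
    by (intro nn_integral_cong pointwise)
  also have "\<dots> = (\<Sum>n. \<integral>\<^sup>+\<omega>. ?F n \<omega> \<partial>M)"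
    by (rule nn_integral_suminf) (rule meas)
  finally show ?thesis
    unfolding int .
qed

lemma (in prob_space) pgf_le_1:
  assumes "X \<in> measurable M (count_space UNIV)" "0 \<le> z" "z \<le> 1"
  shows "pgf M X z \<le> 1"
proof -
  have "(\<integral>\<^sup>+\<omega>. ennreal (z ^ X \<omega>) \<partial>M) \<le> (\<integral>\<^sup>+\<omega>. 1 \<partial>M)"
    using assms by (intro nn_integral_mono) (simp add: power_le_one)
  then show ?thesis
    unfolding nn_integral_pgf[OF assms] by (simp add: emeasure_space_1)
qed

text \<open>A base time \<open>x\<close> survives with probability \<open>s^x\<close>, which turns
  the weight \<open>w^x\<close> into \<open>(w s)^x\<close>.\<close>

lemma (in prob_space) nn_integral_attempt_success:
  assumes indep: "indep_var (count_space UNIV) X (count_space UNIV) tau"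
    and tail: "\<And>t. prob {\<omega> \<in> space M. t < tau \<omega>} = s ^ t"
    and "0 \<le> s" "0 \<le> w" "w * s \<le> 1"
  shows "(\<integral>\<^sup>+\<omega>. (if X \<omega> < tau \<omega> then ennreal (w ^ X \<omega>) else 0) \<partial>M) = ennreal (pgf M X (w * s))"
proof -
  have X: "X \<in> measurable M (count_space UNIV)" and [measurable]: "tau \<in> measurable M (count_space UNIV)"
    using indep_var_rv1[OF indep] indep_var_rv2[OF indep] .
  have "(\<integral>\<^sup>+\<omega>'. (if x < tau \<omega>' then ennreal (w ^ x) else 0) \<partial>M) = ennreal ((w * s) ^ x)" for x
  proof -
    have "(\<integral>\<^sup>+\<omega>'. (if x < tau \<omega>' then ennreal (w ^ x) else 0) \<partial>M)
        = (\<integral>\<^sup>+\<omega>'. ennreal (w ^ x) * indicator {\<omega> \<in> space M. x < tau \<omega>} \<omega>' \<partial>M)"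
      by (intro nn_integral_cong) (simp add: indicator_def)
    also have "\<dots> = ennreal (w ^ x) * ennreal (s ^ x)"
      by (subst nn_integral_cmult_indicator) (simp_all add: emeasure_eq_measure tail)
    also have "\<dots> = ennreal ((w * s) ^ x)"
      using assms by (simp add: ennreal_mult power_mult_distrib)
    finally show ?thesis .
  qed
  then show ?thesis
    using nn_integral_indep_pair[OF indep, of "\<lambda>x t. if x < t then ennreal (w ^ x) else 0"]
      nn_integral_pgf[OF X, of "w * s"] assms by simp
qed

text \<open>For base time \<open>x\<close> the integral of \<open>w^tau\<close> over
  \<open>tau <= x\<close> is a finite geometric sum with value \<open>c (1 - (w s)^x)\<close>;
  averaging over \<open>x\<close> produces \<open>1 - g(w s)\<close>.\<close>

lemma (in prob_space) nn_integral_attempt_failure: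
  assumes indep: "indep_var (count_space UNIV) X (count_space UNIV) tau"
    and tail: "\<And>t. prob {\<omega> \<in> space M. t < tau \<omega>} = s ^ t"
    and s: "0 \<le> s" "s \<le> 1" and w: "0 \<le> w" "w * s < 1"
  shows "(\<integral>\<^sup>+\<omega>. (if X \<omega> < tau \<omega> then 0 else ennreal (w ^ tau \<omega>)) \<partial>M)
    = ennreal ((1 - s) * w * (1 - pgf M X (w * s)) / (1 - w * s))"
proof -
  have X[measurable]: "X \<in> measurable M (count_space UNIV)" and tau[measurable]: "tau \<in> measurable M (count_space UNIV)"
    using indep_var_rv1[OF indep] indep_var_rv2[OF indep] .
  define r where "r t = prob {\<omega> \<in> space M. tau \<omega> = t}" for t
  define c where "c = (1 - s) * w / (1 - w * s)"
  have c: "0 \<le> c"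
    using s w by (simp add: c_def)
  have ws: "0 \<le> w * s"
    using s w by simp
  \<comment> \<open>The tail at \<open>t = 0\<close> is \<open>s^0 = 1\<close>, so
    \<open>tau\<close> is positive almost surely.\<close>
  have r0: "r 0 = 0"
  proof -
    have "r 0 = 1 - prob {\<omega> \<in> space M. 0 < tau \<omega>}"
      unfolding r_def by (subst prob_neg[symmetric]) auto
    then show ?thesis
      by (simp add: tail)
  qed
  have rSuc: "r (Suc t) = (1 - s) * s ^ t" for t
  proof -
    have "r (Suc t) = prob ({\<omega> \<in> space M. t < tau \<omega>} - {\<omega> \<in> space M. Suc t < tau \<omega>})"
      unfolding r_def by (rule arg_cong[where f = prob]) auto
    also have "\<dots> = prob {\<omega> \<in> space M. t < tau \<omega>} - prob {\<omega> \<in> space M. Suc t < tau \<omega>}"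
      by (intro finite_measure_Diff) auto
    finally show ?thesis
      by (simp add: tail algebra_simps)
  qed
  have geom: "(\<Sum>t\<le>x. w ^ t * r t) = c * (1 - (w * s) ^ x)" for x
  proof (induction x)
    case (Suc x)
    have "c * (1 - (w * s) ^ Suc x) - c * (1 - (w * s) ^ x) = c * (1 - w * s) * (w * s) ^ x"
      by (simp add: algebra_simps)
    also have "c * (1 - w * s) = (1 - s) * w"
      using w by (simp add: c_def)
    also have "(1 - s) * w * (w * s) ^ x = w ^ Suc x * r (Suc x)"
      by (simp add: rSuc power_mult_distrib)
    finally show ?case
      unfolding sum.atMost_Suc Suc.IH by linarith
  qed (simp add: r0)
  have "(\<integral>\<^sup>+\<omega>'. (if x < tau \<omega>' then 0 else ennreal (w ^ tau \<omega>')) \<partial>M) = ennreal (c * (1 - (w * s) ^ x))" for x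
  proof -
    have "(\<integral>\<^sup>+\<omega>'. (if x < tau \<omega>' then 0 else ennreal (w ^ tau \<omega>')) \<partial>M)
        = (\<Sum>t. (if x < t then 0 else ennreal (w ^ t)) * ennreal (r t))"
      unfolding r_def by (rule nn_integral_nat[OF tau])
    also have "\<dots> = (\<Sum>t\<le>x. (if x < t then 0 else ennreal (w ^ t)) * ennreal (r t))"
      by (rule suminf_finite) auto
    also have "\<dots> = (\<Sum>t\<le>x. ennreal (w ^ t * r t))"
      using w by (intro sum.cong) (auto simp: ennreal_mult r_def)
    also have "\<dots> = ennreal (\<Sum>t\<le>x. w ^ t * r t)"
      using w by (intro sum_ennreal) (simp add: r_def)
    finally show ?thesis
      unfolding geom .
  qed
  then have "(\<integral>\<^sup>+\<omega>. (if X \<omega> < tau \<omega> then 0 else ennreal (w ^ tau \<omega>)) \<partial>M) = (\<integral>\<^sup>+\<omega>. ennreal (c * (1 - (w * s) ^ X \<omega>)) \<partial>M)"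
    using nn_integral_indep_pair[OF indep, of "\<lambda>x t. if x < t then 0 else ennreal (w ^ t)"] by simp
  also have "\<dots> = ennreal (expectation (\<lambda>\<omega>. c * (1 - (w * s) ^ X \<omega>)))"
    using c ws w
    by (intro nn_integral_eq_integral integrable_const_bound[where B = c])
      (auto simp: power_le_one mult_left_le)
  also have "expectation (\<lambda>\<omega>. c * (1 - (w * s) ^ X \<omega>)) = c * (1 - pgf M X (w * s))"
  proof -
    have "integrable M (\<lambda>\<omega>. (w * s) ^ X \<omega>)"
      using ws w by (intro integrable_const_bound[where B = 1]) (auto simp: power_le_one)
    then show ?thesis
      by (simp add: pgf_def prob_space)
  qed
  finally show ?thesis
    by (simp add: c_def)
qed

subsection \<open>From power series identities to the recursion\<close>

text \<open>Zeros of a nonzero power series are isolated, so vanishing on a one-sided interval is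
  enough. Multiplying by \<open>fps_X\<close> forces the value 0 at the origin and a nonzero
  coefficient of positive index, as \<open>powser_0_nonzero\<close> requires.\<close>

lemma fps_eq_0_if_eval_fps_0:
  fixes F :: "real fps"
  assumes r: "0 < r" "ereal r \<le> fps_conv_radius F" and zero: "\<And>u. 0 < u \<Longrightarrow> u < r \<Longrightarrow> eval_fps F u = 0"
  shows "F = 0"
proof (rule ccontr)
  assume "F \<noteq> 0"
  then obtain m where m: "fps_nth (fps_X * F) (Suc m) \<noteq> 0"
    by (auto simp: fps_eq_iff)
  have "(\<lambda>n. fps_nth (fps_X * F) n * (x - 0) ^ n) sums (x * eval_fps F x)" if "norm (x - 0) < r" for x
  proof -
    have rad: "ereal (norm x) < fps_conv_radius F"
      using that r(2) by (metis diff_zero less_ereal.simps(1) less_le_trans)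
    then have "(\<lambda>n. fps_nth F n * x ^ n) sums eval_fps F x"
      by (rule sums_eval_fps)
    from sums_mult[OF this, of x] have "(\<lambda>n. fps_nth (fps_X * F) (Suc n) * x ^ Suc n) sums (x * eval_fps F x)"
      by (simp add: mult_ac)
    then show ?thesis
      by (subst (asm) sums_Suc_iff) simp
  qed
  from powser_0_nonzero[OF r(1) this _ m] obtain t
    where t: "0 < t" "\<And>z. z \<in> cball 0 t - {0} \<Longrightarrow> z * eval_fps F z \<noteq> 0"
    by auto
  define z where "z = min t (r / 2)"
  have "0 < z" "z \<le> t" "z < r"
    using t(1) r(1) by (auto simp: z_def)
  then show False
    using t(2)[of z] zero[of z] by (simp add: dist_real_def)
qed

text \<open>This and the next two are closure rules that pass one common radius through products,
  sums and differences.\<close>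

lemma le_fps_conv_radius_mult:
  "r \<le> fps_conv_radius f \<Longrightarrow> r \<le> fps_conv_radius g \<Longrightarrow> r \<le> fps_conv_radius (f * g)"
  for f g :: "real fps"
  using fps_conv_radius_mult[of f g] by (metis min.bounded_iff order_trans)

lemma le_fps_conv_radius_add:
  "r \<le> fps_conv_radius f \<Longrightarrow> r \<le> fps_conv_radius g \<Longrightarrow> r \<le> fps_conv_radius (f + g)"
  for f g :: "real fps"
  using fps_conv_radius_add[of f g] by (metis min.bounded_iff order_trans)

lemma le_fps_conv_radius_diff:
  "r \<le> fps_conv_radius f \<Longrightarrow> r \<le> fps_conv_radius g \<Longrightarrow> r \<le> fps_conv_radius (f - g)"
  for f g :: "real fps"
  using fps_conv_radius_diff[of f g] by (metis min.bounded_iff order_trans)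

text \<open>Ties the formal series to the functions \<open>D(w)\<close> and \<open>N(w)\<close> at
  \<open>w = 1 + u\<close>, where \<open>-u\<close> is \<open>1 - w\<close>.\<close>

lemma
  assumes r: "ereal r \<le> fps_conv_radius (g_series q d)"
  shows le_conv_radius_D_series: "ereal r \<le> fps_conv_radius (D_series q d)"
    and le_conv_radius_N_series: "ereal r \<le> fps_conv_radius (N_series q d)"
    and eval_D_series: "norm u < r \<Longrightarrow> eval_fps (D_series q d) u = - u + q * (1 + u) * eval_fps (g_series q d) u"
    and eval_N_series: "norm u < r \<Longrightarrow> eval_fps (N_series q d) u = (1 - (1 - q) * (1 + u)) * eval_fps (g_series q d) u"
proof -
  let ?G = "g_series q d"
  have lin: "ereal r' \<le> fps_conv_radius (1 + fps_X :: real fps)" for r'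
    by (intro le_fps_conv_radius_add) auto
  have lin_D: "ereal r' \<le> fps_conv_radius (fps_const q * (1 + fps_X))" for r'
    by (intro le_fps_conv_radius_mult lin) auto
  have lin_N: "ereal r' \<le> fps_conv_radius (1 - fps_const (1 - q) * (1 + fps_X))" for r'
    by (intro le_fps_conv_radius_mult le_fps_conv_radius_diff lin) auto
  have X: "ereal r' \<le> fps_conv_radius (- fps_X :: real fps)" for r'
    by simp
  show "ereal r \<le> fps_conv_radius (D_series q d)"
    unfolding D_series_def by (intro le_fps_conv_radius_add le_fps_conv_radius_mult[OF lin_D] X r)
  show "ereal r \<le> fps_conv_radius (N_series q d)"
    unfolding N_series_def by (intro le_fps_conv_radius_mult[OF lin_N] r)
  assume u: "norm u < r"
  have lt: "ereal (norm u) < R" if "ereal r \<le> R" for R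
    using that u by (metis less_ereal.simps(1) less_le_trans)
  have lin_eval: "eval_fps (fps_const c * (1 + fps_X)) u = c * (1 + u)" for c
    by (subst eval_fps_mult[OF _ lt[OF lin]]) (simp_all add: eval_fps_add)
  have "eval_fps (D_series q d) u = eval_fps (- fps_X) u + eval_fps (fps_const q * (1 + fps_X) * ?G) u"
    unfolding D_series_def by (intro eval_fps_add lt X le_fps_conv_radius_mult lin_D r)
  also have "eval_fps (fps_const q * (1 + fps_X) * ?G) u = eval_fps (fps_const q * (1 + fps_X)) u * eval_fps ?G u"
    by (intro eval_fps_mult lt lin_D r)
  finally show "eval_fps (D_series q d) u = - u + q * (1 + u) * eval_fps ?G u"
    by (simp add: eval_fps_minus lin_eval)
  have "eval_fps (N_series q d) u = eval_fps (1 - fps_const (1 - q) * (1 + fps_X)) u * eval_fps ?G u"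
    unfolding N_series_def by (intro eval_fps_mult lt lin_N r)
  also have "eval_fps (1 - fps_const (1 - q) * (1 + fps_X)) u = eval_fps 1 u - eval_fps (fps_const (1 - q) * (1 + fps_X)) u"
    by (intro eval_fps_diff lt le_fps_conv_radius_mult lin) simp_all
  finally show "eval_fps (N_series q d) u = (1 - (1 - q) * (1 + u)) * eval_fps ?G u"
    by (simp add: lin_eval)
qed

text \<open>The recursion is the coefficient of \<open>u\<^sup>k\<close> in the identity \<open>D G = N\<close>.\<close>
lemma eta_expr_eq_coeff:
  assumes "q \<noteq> 0" "d 0 \<noteq> 0" and F0: "fps_nth F 0 = 1" and eq: "D_series q d * F = N_series q d"
  shows "eta_expr q d k = fact k * fps_nth F k"
proof (induction k rule: less_induct)
  case (less k)
  show ?case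
  proof (cases k)
    case 0
    then show ?thesis
      using F0 by simp
  next
    case (Suc n)
    let ?D = "fps_nth (D_series q d)"
    \<comment> \<open>As \<open>(k choose j) j! (k - j)! = k!\<close>, the summands of the recursion
      are \<open>k!\<close> times the terms of a Cauchy product.\<close>
    have binom: "real (k choose j) * deriv_at_1 (D_series q d) j * (fact (k - j) * y) = fact k * (?D j * y)"
      if "j \<le> k" for j y
      using that by (simp add: deriv_at_1_def binomial_fact)
    have D0: "?D 0 = q * d 0"
      by (simp add: D_series_def g_series_def)
    have "(\<Sum>j = 0..k. ?D j * fps_nth F (k - j)) = fps_nth (N_series q d) k"
      unfolding eq[symmetric] by (simp add: fps_mult_nth)
    then have "fact k * fps_nth (N_series q d) k = (\<Sum>j = 0..k. fact k * (?D j * fps_nth F (k - j)))"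
      by (simp add: sum_distrib_left[symmetric])
    \<comment> \<open>The term \<open>j = 0\<close> carries the unknown coefficient with factor
      \<open>q p\<close>; the term \<open>j = k\<close> has the constant coefficient 1 of
      \<open>F\<close> and later joins the \<open>N\<close> coefficient to form
      \<open>Delta\<close>.\<close>
    also have "\<dots> = fact k * (q * d 0 * fps_nth F k) + (\<Sum>j = 1..n. fact k * (?D j * fps_nth F (k - j))) + fact k * ?D k"
      using Suc F0 D0 by (simp add: sum.atLeast_Suc_atMost)
    also have "(\<Sum>j = 1..n. fact k * (?D j * fps_nth F (k - j)))
        = (\<Sum>j = 1..n. real (k choose j) * deriv_at_1 (D_series q d) j * eta_expr q d (k - j))"
    proof (intro sum.cong refl)
      fix j assume "j \<in> {1..n}"
      then have j: "j \<le> k" "k - j < k"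
        using Suc by auto
      show "fact k * (?D j * fps_nth F (k - j)) = real (k choose j) * deriv_at_1 (D_series q d) j * eta_expr q d (k - j)"
        unfolding less.IH[OF j(2)] binom[OF j(1)] ..
    qed
    finally have "Delta q d k - (\<Sum>j = 1..n. real (k choose j) * deriv_at_1 (D_series q d) j * eta_expr q d (k - j))
        = d 0 * q * (fact k * fps_nth F k)"
      unfolding Delta_def deriv_at_1_def[of _ k] by (simp only: algebra_simps)
    moreover have "eta_expr q d k = 1 / (d 0 * q) *
        (Delta q d k - (\<Sum>j = 1..n. real (k choose j) * deriv_at_1 (D_series q d) j * eta_expr q d (k - j)))"
      unfolding Suc by (rule eta_expr.simps)
    ultimately show ?thesis
      using assms(1,2) by simp
  qed
qed

subsection \<open>The generating function of the completion time\<close>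

text \<open>Equality in law is stated relative to \<open>X 1\<close>, so that everything lives on
  one space; \<open>s\<close> stands for \<open>1 - q\<close>.\<close>

locale memoryless_catastrophe = prob_space M for M :: "'a measure" +
  fixes X tau :: "nat \<Rightarrow> 'a \<Rightarrow> nat" and s :: real
  assumes s: "0 < s" "s < 1"
    and attempts_indep: "indep_vars (\<lambda>_. count_space UNIV) (\<lambda>i \<omega>. (X i \<omega>, tau i \<omega>)) {1..}"
    and pair_indep: "\<And>i. 1 \<le> i \<Longrightarrow> indep_var (count_space UNIV) (X i) (count_space UNIV) (tau i)"
    and X_distr: "\<And>i. 1 \<le> i \<Longrightarrow> distr M (count_space UNIV) (X i) = distr M (count_space UNIV) (X 1)"
    and tau_tail: "\<And>i t. 1 \<le> i \<Longrightarrow> prob {\<omega> \<in> space M. t < tau i \<omega>} = s ^ t"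
begin

abbreviation "g \<equiv> pgf M (X 1)"
abbreviation "T \<equiv> completion_time X tau"

lemma X_measurable: "1 \<le> i \<Longrightarrow> X i \<in> measurable M (count_space UNIV)"
  by (rule indep_var_rv1[OF pair_indep])

lemma T_measurable [measurable]: "T \<in> measurable M (count_space UNIV)"
  using attempts_indep by (intro measurable_completion_time) (auto simp: indep_vars_def)

lemma pgf_X: "1 \<le> i \<Longrightarrow> pgf M (X i) z = g z"
proof -
  have *: "pgf M (X i) z = (\<integral>n. z ^ n \<partial>distr M (count_space UNIV) (X i))" if "1 \<le> i" for i
    unfolding pgf_def using X_measurable[OF that] by (subst integral_distr) auto
  assume "1 \<le> i"
  then show ?thesis
    using *[of i] *[of 1] X_distr[of i] by simp
qed

lemma g_pos: "0 < g s"
  using funpow_deriv_pgf_pos[OF X_measurable[of 1] s, of 0] prob_space by simp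

text \<open>Since \<open>1 - b = D(w) / (1 - w s)\<close>, positivity of \<open>D(w)\<close> is
  exactly the condition \<open>b < 1\<close> under which the geometric series sums to
  \<open>a / (1 - b)\<close>.\<close>

lemma nn_integral_success:
  assumes w: "0 \<le> w" "w * s < 1" and denom: "0 < (1 - w) + (1 - s) * w * g (w * s)"
  shows "(\<integral>\<^sup>+\<omega>. (if \<exists>i\<ge>1. X i \<omega> < tau i \<omega> then ennreal (w ^ T \<omega>) else 0) \<partial>M)
    = ennreal ((1 - w * s) * g (w * s) / ((1 - w) + (1 - s) * w * g (w * s)))"
proof -
  define a where "a = g (w * s)"
  define b where "b = (1 - s) * w * (1 - a) / (1 - w * s)"
  have ws: "0 \<le> w * s"
    using s w by simp
  have a: "0 \<le> a" "a \<le> 1"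
    unfolding a_def using ws w pgf_nonneg[of "w * s" "X 1"] pgf_le_1[of "X 1" "w * s"] X_measurable[of 1] by simp_all
  have one_minus_b: "1 - b = ((1 - w) + (1 - s) * w * a) / (1 - w * s)"
    using w by (simp add: b_def field_simps)
  have b: "0 \<le> b" "b < 1"
  proof -
    show "0 \<le> b"
      using s w a by (simp add: b_def)
    have "0 < 1 - b"
      unfolding one_minus_b using denom w by (simp add: a_def)
    then show "b < 1"
      by simp
  qed
  have "(\<integral>\<^sup>+\<omega>. (if \<exists>i\<ge>1. X i \<omega> < tau i \<omega> then ennreal (w ^ T \<omega>) else 0) \<partial>M) = (\<Sum>n. ennreal b ^ n * ennreal a)"
  proof (rule nn_integral_completion_time[OF attempts_indep w(1)])
    fix i :: nat assume i: "1 \<le> i"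
    show "(\<integral>\<^sup>+\<omega>. (if X i \<omega> < tau i \<omega> then ennreal (w ^ X i \<omega>) else 0) \<partial>M) = ennreal a"
      using nn_integral_attempt_success[OF pair_indep[OF i] tau_tail[OF i]] s w by (simp add: pgf_X[OF i] a_def)
    show "(\<integral>\<^sup>+\<omega>. (if X i \<omega> < tau i \<omega> then 0 else ennreal (w ^ tau i \<omega>)) \<partial>M) = ennreal b"
      using nn_integral_attempt_failure[OF pair_indep[OF i] tau_tail[OF i]] s w by (simp add: pgf_X[OF i] a_def b_def)
  qed
  also have "\<dots> = (\<Sum>n. ennreal (b ^ n * a))"
    using a b by (simp add: ennreal_mult ennreal_power)
  also have "\<dots> = ennreal (1 / (1 - b) * a)"
  proof -
    have "(\<lambda>n. b ^ n * a) sums (1 / (1 - b) * a)"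
      using b by (intro sums_mult2 geometric_sums) simp
    then have "(\<lambda>n. ennreal (b ^ n * a)) sums ennreal (1 / (1 - b) * a)"
      using a b by (subst sums_ennreal) auto
    then show ?thesis
      by (simp add: sums_iff)
  qed
  also have "1 / (1 - b) * a = (1 - w * s) * a / ((1 - w) + (1 - s) * w * a)"
    unfolding one_minus_b by simp
  finally show ?thesis
    by (simp add: a_def)
qed

text \<open>At \<open>w = 1\<close> the formula reads \<open>q g(s) / (q g(s)) = 1\<close>, the mass
  of the success event. So the unspecified value of \<open>LEAST\<close> matters only on a null
  set.\<close>

lemma AE_success: "AE \<omega> in M. \<exists>i\<ge>1. X i \<omega> < tau i \<omega>"
proof -
  let ?S = "{\<omega> \<in> space M. \<exists>i\<ge>1. X i \<omega> < tau i \<omega>}"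
  have success: "{\<omega> \<in> space M. X i \<omega> < tau i \<omega>} \<in> sets M" if "1 \<le> i" for i
  proof -
    have "(\<lambda>\<omega>. (X i \<omega>, tau i \<omega>)) \<in> measurable M (count_space UNIV)"
      using attempts_indep that by (auto simp: indep_vars_def)
    from measurable_sets[OF this, of "{(x, t). x < t}"] show ?thesis
      by (simp add: vimage_def Int_def conj_commute)
  qed
  have "?S = (\<Union>i\<in>{1..}. {\<omega> \<in> space M. X i \<omega> < tau i \<omega>})"
    by auto
  also have "\<dots> \<in> sets M"
    using success by (intro sets.countable_UN') auto
  finally have S: "?S \<in> sets M" .
  have "emeasure M ?S = (\<integral>\<^sup>+\<omega>. indicator ?S \<omega> \<partial>M)"
    by (rule nn_integral_indicator[OF S, symmetric])
  also have "\<dots> = (\<integral>\<^sup>+\<omega>. (if \<exists>i\<ge>1. X i \<omega> < tau i \<omega> then ennreal (1 ^ T \<omega>) else 0) \<partial>M)"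
    by (intro nn_integral_cong) (simp add: indicator_def)
  also have "\<dots> = 1"
    using s g_pos by (subst nn_integral_success) auto
  finally have "prob ?S = 1"
    by (simp add: emeasure_eq_measure)
  then have "AE \<omega> in M. \<omega> \<in> ?S"
    unfolding prob_eq_1[OF S] .
  then show ?thesis
    by (rule AE_mp) (intro AE_I2 impI, blast)
qed

text \<open>The bound \<open>u < q p\<close> keeps \<open>D(1 + u)\<close> positive, because
  \<open>g\<close> is nondecreasing and so \<open>q (1 + u) g(s (1 + u)) >= q g(s) > u\<close>. It
  also keeps \<open>s (1 + u)\<close> below 1, as \<open>u < q\<close> and
  \<open>s (1 + q) = 1 - q^2\<close>.\<close>

lemma nn_integral_T:
  assumes u: "0 \<le> u" "u < (1 - s) * g s"
  shows "(\<integral>\<^sup>+\<omega>. ennreal ((1 + u) ^ T \<omega>) \<partial>M)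
      = ennreal ((1 - s * (1 + u)) * g (s * (1 + u)) / (- u + (1 - s) * (1 + u) * g (s * (1 + u))))"
    and "s * (1 + u) < 1" and "0 < - u + (1 - s) * (1 + u) * g (s * (1 + u))"
proof -
  have g_le_1: "g s \<le> 1"
    using s X_measurable[of 1] by (intro pgf_le_1) auto
  then have "(1 - s) * g s \<le> (1 - s) * 1"
    using s by (intro mult_left_mono) auto
  from less_le_trans[OF u(2) this] have "u < 1 - s"
    by simp
  then have "s * (1 + u) < s * (1 + (1 - s))"
    using s by simp
  also have "\<dots> = 1 - (1 - s)\<^sup>2"
    by (simp add: power2_eq_square algebra_simps)
  also have "\<dots> \<le> 1"
    by simp
  finally show ws: "s * (1 + u) < 1" .
  have "ennreal (g s) \<le> ennreal (g (s * (1 + u)))"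
    unfolding nn_integral_pgf[OF X_measurable[of 1], of s, symmetric, OF order_refl less_imp_le[OF s(1)] less_imp_le[OF s(2)]]
    using u s ws X_measurable[of 1]
    by (subst nn_integral_pgf[symmetric]) (auto intro!: nn_integral_mono power_mono ennreal_leI)
  then have g_mono: "g s \<le> g (s * (1 + u))"
    using u s by (subst (asm) ennreal_le_iff) (auto intro: pgf_nonneg)
  have "u < (1 - s) * g s"
    by (rule u)
  also have "\<dots> \<le> (1 - s) * g (s * (1 + u))"
    using s g_mono by (intro mult_left_mono) auto
  also have "\<dots> \<le> (1 - s) * (1 + u) * g (s * (1 + u))"
    using s u g_mono g_pos by (intro mult_right_mono) auto
  finally show denom: "0 < - u + (1 - s) * (1 + u) * g (s * (1 + u))"
    by simp
  have "(\<integral>\<^sup>+\<omega>. ennreal ((1 + u) ^ T \<omega>) \<partial>M)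
      = (\<integral>\<^sup>+\<omega>. (if \<exists>i\<ge>1. X i \<omega> < tau i \<omega> then ennreal ((1 + u) ^ T \<omega>) else 0) \<partial>M)"
    using AE_success by (intro nn_integral_cong_AE) auto
  also have "\<dots> = ennreal ((1 - s * (1 + u)) * g (s * (1 + u)) / (- u + (1 - s) * (1 + u) * g (s * (1 + u))))"
    using u ws denom by (subst nn_integral_success) (auto simp: mult.commute[of _ s])
  finally show "(\<integral>\<^sup>+\<omega>. ennreal ((1 + u) ^ T \<omega>) \<partial>M)
      = ennreal ((1 - s * (1 + u)) * g (s * (1 + u)) / (- u + (1 - s) * (1 + u) * g (s * (1 + u))))" .
qed

text \<open>Each moment times \<open>u^k\<close> is at most the integral of
  \<open>(1 + u)^T\<close>, which is finite at one positive \<open>u\<close>.\<close>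

lemma integrable_T_choose: "integrable M (\<lambda>\<omega>. real (T \<omega> choose k))"
proof -
  define u where "u = (1 - s) * g s / 2"
  have u: "0 < u" "u < (1 - s) * g s"
    using s g_pos by (auto simp: u_def)
  have "(\<Sum>j. (\<integral>\<^sup>+\<omega>. ennreal (1 * real (T \<omega> choose j)) \<partial>M) * ennreal (u ^ j)) = (\<integral>\<^sup>+\<omega>. ennreal (1 * (1 + u) ^ T \<omega>) \<partial>M)"
    using u by (intro nn_integral_power_binomial[symmetric]) auto
  then have "(\<Sum>j. (\<integral>\<^sup>+\<omega>. ennreal (real (T \<omega> choose j)) \<partial>M) * ennreal (u ^ j)) < \<infinity>"
    using u by (simp add: nn_integral_T)
  moreover have "(\<integral>\<^sup>+\<omega>. ennreal (real (T \<omega> choose k)) \<partial>M) * ennreal (u ^ k)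
      \<le> (\<Sum>j. (\<integral>\<^sup>+\<omega>. ennreal (real (T \<omega> choose j)) \<partial>M) * ennreal (u ^ j))"
    using sum_le_suminf[OF summableI, of "{k}" "\<lambda>j. (\<integral>\<^sup>+\<omega>. ennreal (real (T \<omega> choose j)) \<partial>M) * ennreal (u ^ j)"] by simp
  ultimately have "(\<integral>\<^sup>+\<omega>. ennreal (real (T \<omega> choose k)) \<partial>M) * ennreal (u ^ k) \<noteq> top"
    by auto
  then have "(\<integral>\<^sup>+\<omega>. ennreal (real (T \<omega> choose k)) \<partial>M) < \<infinity>"
    using u by (auto simp: ennreal_mult_eq_top_iff less_top)
  then show ?thesis
    by (intro integrableI_bounded) auto
qed

lemma T_choose_sums:
  assumes u: "0 \<le> u" "u < (1 - s) * g s"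
  shows "(\<lambda>k. expectation (\<lambda>\<omega>. real (T \<omega> choose k)) * u ^ k) sums
    ((1 - s * (1 + u)) * g (s * (1 + u)) / (- u + (1 - s) * (1 + u) * g (s * (1 + u))))"
proof -
  let ?b = "\<lambda>k. expectation (\<lambda>\<omega>. real (T \<omega> choose k))"
  let ?r = "(1 - s * (1 + u)) * g (s * (1 + u)) / (- u + (1 - s) * (1 + u) * g (s * (1 + u)))"
  have b_nonneg: "0 \<le> ?b k" for k
    by simp
  have int: "(\<integral>\<^sup>+\<omega>. ennreal (real (T \<omega> choose k)) \<partial>M) = ennreal (?b k)" for k
    by (intro nn_integral_eq_integral integrable_T_choose) auto
  have "(\<Sum>k. (\<integral>\<^sup>+\<omega>. ennreal (1 * real (T \<omega> choose k)) \<partial>M) * ennreal (u ^ k)) = (\<integral>\<^sup>+\<omega>. ennreal (1 * (1 + u) ^ T \<omega>) \<partial>M)"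
    using u by (intro nn_integral_power_binomial[symmetric]) auto
  then have "(\<Sum>k. ennreal (?b k * u ^ k)) = ennreal ?r"
    using u by (simp add: int nn_integral_T ennreal_mult[OF b_nonneg])
  then have "(\<lambda>k. ennreal (?b k * u ^ k)) sums ennreal ?r"
    by (simp add: sums_iff)
  moreover have "0 \<le> ?r"
    using u s nn_integral_T(2,3)[OF u] by (intro divide_nonneg_pos mult_nonneg_nonneg pgf_nonneg) auto
  moreover have "0 \<le> ?b k * u ^ k" for k
    using b_nonneg u by (intro mult_nonneg_nonneg) auto
  ultimately show ?thesis
    by (subst (asm) sums_ennreal)
qed

text \<open>The moment recursion for the true moments: \<open>D F = N\<close> holds for the values
  on an interval to the right of 0, hence as formal series, and comparing coefficients gives
  \<open>eta_expr\<close>.\<close>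

lemma factorial_moment_eq_eta_expr:
  "expectation (\<lambda>\<omega>. real (T \<omega> choose k)) * fact k = eta_expr (1 - s) (\<lambda>j. (deriv ^^ j) g s) k"
proof -
  define d where "d = (\<lambda>j. (deriv ^^ j) g s)"
  define F where "F = Abs_fps (\<lambda>k. expectation (\<lambda>\<omega>. real (T \<omega> choose k)))"
  \<comment> \<open>Half of the admissible bound, so that the series still converge at the endpoint
    \<open>r\<close>, which gives the lower bound on their radii.\<close>
  define r where "r = (1 - s) * g s / 2"
  have r: "0 < r" "r < (1 - s) * g s"
    using s g_pos by (auto simp: r_def)
  have F: "(\<lambda>k. fps_nth F k * u ^ k) sums
      ((1 - s * (1 + u)) * g (s * (1 + u)) / (- u + (1 - s) * (1 + u) * g (s * (1 + u))))"
    if "0 \<le> u" "u \<le> r" for u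
    unfolding F_def fps_nth_Abs_fps using that r by (intro T_choose_sums) auto
  have G: "(\<lambda>k. fps_nth (g_series (1 - s) d) k * u ^ k) sums g (s * (1 + u))"
    if "0 \<le> u" "u \<le> r" for u
    using pgf_taylor_sums[OF X_measurable[of 1] s(1), of u] that r nn_integral_T(2)[of u]
    by (simp add: g_series_def d_def)
  have rad_F: "ereal r \<le> fps_conv_radius F"
    using conv_radius_geI[OF sums_summable[OF F[of r]]] r by (simp add: fps_conv_radius_def)
  have rad_G: "ereal r \<le> fps_conv_radius (g_series (1 - s) d)"
    using conv_radius_geI[OF sums_summable[OF G[of r]]] r by (simp add: fps_conv_radius_def)
  note rads = rad_F le_conv_radius_D_series[OF rad_G] le_conv_radius_N_series[OF rad_G]
  have "D_series (1 - s) d * F - N_series (1 - s) d = 0"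
  proof (rule fps_eq_0_if_eval_fps_0[OF r(1)])
    show "ereal r \<le> fps_conv_radius (D_series (1 - s) d * F - N_series (1 - s) d)"
      by (intro le_fps_conv_radius_diff le_fps_conv_radius_mult rads)
    fix u assume u: "0 < u" "u < r"
    have lt: "ereal (norm u) < R" if "ereal r \<le> R" for R
      using that u by (auto intro: less_le_trans[of _ "ereal r"])
    have "eval_fps (D_series (1 - s) d * F - N_series (1 - s) d) u =
        eval_fps (D_series (1 - s) d) u * eval_fps F u - eval_fps (N_series (1 - s) d) u"
      using rads by (subst eval_fps_diff) (auto intro!: lt le_fps_conv_radius_mult eval_fps_mult simp del: real_norm_def)
    also have "\<dots> = 0"
    proof -
      have "eval_fps (g_series (1 - s) d) u = g (s * (1 + u))"
        using G[of u] u by (simp add: eval_fps_def sums_iff)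
      moreover have "eval_fps F u = (1 - s * (1 + u)) * g (s * (1 + u)) / (- u + (1 - s) * (1 + u) * g (s * (1 + u)))"
        using F[of u] u by (simp add: eval_fps_def sums_iff)
      moreover have "- u + (1 - s) * (1 + u) * g (s * (1 + u)) \<noteq> 0"
        using nn_integral_T(3)[of u] u r by simp
      ultimately show ?thesis
        using u eval_D_series[OF rad_G, of u] eval_N_series[OF rad_G, of u] by simp
    qed
    finally show "eval_fps (D_series (1 - s) d * F - N_series (1 - s) d) u = 0" .
  qed
  then have "eta_expr (1 - s) d k = fact k * fps_nth F k"
    using s g_pos by (intro eta_expr_eq_coeff) (auto simp: d_def F_def prob_space)
  then show ?thesis
    by (simp add: d_def F_def mult.commute)
qed

end

section \<open>The theorem for a base time on its own probability space\<close>

lemma falling_factorial_eq: "falling_factorial k n = fact k * real (n choose k)"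
  by (simp add: falling_factorial_def binomial_gbinomial gbinomial_prod_rev atLeast0LessThan)

theorem proposition2p10:
  fixes q s p :: real
    and N :: "'b measure" and T0 :: "'b \<Rightarrow> nat"
    and M :: "'a measure" and X tau :: "nat \<Rightarrow> 'a \<Rightarrow> nat"
    and T :: "'a \<Rightarrow> nat" and D eta :: "nat \<Rightarrow> real"
  assumes q: "0 < q" "q < 1" and s: "s = 1 - q"
    and base: "prob_space N" "T0 \<in> measurable N (count_space UNIV)" "AE \<omega> in N. 1 \<le> T0 \<omega>"
    and space: "prob_space M"
    and attempts_indep:
      "prob_space.indep_vars M (\<lambda>_. count_space UNIV) (\<lambda>i \<omega>. (X i \<omega>, tau i \<omega>)) {1..}"
    and pair_indep:
      "\<And>i. 1 \<le> i \<Longrightarrow> prob_space.indep_var M (count_space UNIV) (X i) (count_space UNIV) (tau i)"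
    and X_copy:
      "\<And>i. 1 \<le> i \<Longrightarrow> distr M (count_space UNIV) (X i) = distr N (count_space UNIV) T0"
    and tau_tail: "\<And>i t. 1 \<le> i \<Longrightarrow> measure M {\<omega> \<in> space M. t < tau i \<omega>} = s ^ t"
    and T: "T = completion_time X tau"
    and p: "p = pgf N T0 s"
    and D: "\<And>j. D j = (deriv ^^ j) (pgf N T0) s"
    and eta: "\<And>k. eta k = integral\<^sup>L M (\<lambda>\<omega>. falling_factorial k (T \<omega>))"
  shows
    "(\<forall>k\<ge>2.
        integrable M (\<lambda>\<omega>. falling_factorial k (T \<omega>)) \<and>
        eta k = eta_expr q D k \<and>
        (\<exists>R :: real \<Rightarrow> real list \<Rightarrow> real.
           (\<forall>q' d. 0 < q' \<longrightarrow> q' < 1 \<longrightarrow> d 0 \<noteq> 0 \<longrightarrow>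
              eta_expr q' d k =
                - (real k * (1 - q') ^ (k - 1) / ((d 0)\<^sup>2 * q')) * d (k - 1)
                + R q' (map d [0..<k - 1])) \<and>
           eta k = - (real k * s ^ (k - 1) / (p\<^sup>2 * q)) * D (k - 1) + R q (map D [0..<k - 1])) \<and>
        - (real k * s ^ (k - 1) / (p\<^sup>2 * q)) \<noteq> 0 \<and>
        (D (k - 1) \<noteq> 0 \<longrightarrow> - (real k * s ^ (k - 1) / (p\<^sup>2 * q)) * D (k - 1) \<noteq> 0) \<and>
        (measure N {\<omega> \<in> space N. k \<le> T0 \<omega>} > 0 \<longrightarrow> D (k - 1) \<noteq> 0)) \<and>
     ((\<forall>n. \<exists>m>n. measure N {\<omega> \<in> space N. T0 \<omega> = m} > 0) \<longrightarrow>
        (\<forall>k\<ge>2. derivs_in q k - (\<Union>j<k. derivs_in q j) = {k - 1} \<and> D (k - 1) \<noteq> 0))"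
proof -
  interpret N: prob_space N
    by (rule base)
  interpret M: prob_space M
    by (rule space)
  have s01: "0 < s" "s < 1" and q_eq: "q = 1 - s" and s_eq: "s = 1 - q"
    using q s by auto
  have X_meas: "X i \<in> measurable M (count_space UNIV)" if "1 \<le> i" for i
    by (rule M.indep_var_rv1[OF pair_indep[OF that]])
  interpret memoryless_catastrophe M X tau s
    using s01 attempts_indep pair_indep tau_tail X_copy by unfold_locales auto
  \<comment> \<open>A generating function depends only on the law, so \<open>T0\<close> on
    \<open>N\<close> may be replaced by \<open>X 1\<close> on \<open>M\<close>.\<close>
  have "pgf N T0 z = pgf M (X 1) z" for z
  proof -
    have "pgf N T0 z = (\<integral>n. z ^ n \<partial>distr N (count_space UNIV) T0)"
      unfolding pgf_def using base(2) by (subst integral_distr) auto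
    also have "\<dots> = (\<integral>n. z ^ n \<partial>distr M (count_space UNIV) (X 1))"
      by (simp only: X_copy[OF order_refl])
    also have "\<dots> = pgf M (X 1) z"
      unfolding pgf_def using X_meas[of 1] by (subst integral_distr) auto
    finally show ?thesis .
  qed
  then have pgf_eq: "pgf N T0 = pgf M (X 1)"
    by blast
  have D_eq: "D = (\<lambda>j. (deriv ^^ j) (pgf M (X 1)) s)"
    using D by (auto simp: pgf_eq)
  have p_eq: "p = D 0"
    by (simp add: p D_eq pgf_eq)
  have p_pos: "0 < p"
    using g_pos by (simp only: p pgf_eq)
  have integrable: "integrable M (\<lambda>\<omega>. falling_factorial k (T \<omega>))" for k
    unfolding T falling_factorial_eq by (intro integrable_mult_right integrable_T_choose)
  have eta_eq: "eta k = eta_expr q D k" for k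
    unfolding eta T falling_factorial_eq q_eq D_eq factorial_moment_eq_eta_expr[symmetric]
    by (simp add: mult.commute)
  have coeff: "- (real k * s ^ (k - 1) / (p\<^sup>2 * q)) \<noteq> 0" if "2 \<le> k" for k
    using that s01 p_pos q by simp
  \<comment> \<open>Positivity of the derivative of order \<open>k - 1\<close> needs mass on
    \<open>T0 >= k - 1\<close>, which contains the event \<open>T0 >= k\<close>.\<close>
  have D_nonzero: "D (k - 1) \<noteq> 0" if "0 < measure N {\<omega> \<in> space N. k \<le> T0 \<omega>}" for k
  proof -
    note [measurable] = base(2)
    have "measure N {\<omega> \<in> space N. k \<le> T0 \<omega>} \<le> measure N {\<omega> \<in> space N. k - 1 \<le> T0 \<omega>}"
      by (intro N.finite_measure_mono) auto
    then have "0 < measure N {\<omega> \<in> space N. k - 1 \<le> T0 \<omega>}"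
      using that by linarith
    then show ?thesis
      using N.funpow_deriv_pgf_pos[OF base(2) s01, of "k - 1"] by (simp add: D)
  qed
  have remainder: "\<exists>R :: real \<Rightarrow> real list \<Rightarrow> real.
           (\<forall>q' d. 0 < q' \<longrightarrow> q' < 1 \<longrightarrow> d 0 \<noteq> 0 \<longrightarrow>
              eta_expr q' d k =
                - (real k * (1 - q') ^ (k - 1) / ((d 0)\<^sup>2 * q')) * d (k - 1)
                + R q' (map d [0..<k - 1])) \<and>
           eta k = - (real k * s ^ (k - 1) / (p\<^sup>2 * q)) * D (k - 1) + R q (map D [0..<k - 1])"
    if k: "2 \<le> k" for k
  proof -
    obtain R :: "real \<Rightarrow> real list \<Rightarrow> real" where R: "\<And>q d. 0 < q \<Longrightarrow> q < 1 \<Longrightarrow> d 0 \<noteq> 0 \<Longrightarrow>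
        eta_expr q d k = - (real k * (1 - q) ^ (k - 1) / ((d 0)\<^sup>2 * q)) * d (k - 1) + R q (map d [0..<k - 1])"
      using eta_expr_remainder[OF k] by blast
    have "D 0 \<noteq> 0"
      using p_pos p_eq by simp
    \<comment> \<open>The same \<open>R\<close> serves all parameters and sequences; here it is
      specialised to the true derivatives.\<close>
    from R[of q D, OF q this] have "eta k = - (real k * s ^ (k - 1) / (p\<^sup>2 * q)) * D (k - 1) + R q (map D [0..<k - 1])"
      unfolding eta_eq p_eq s_eq .
    with R show ?thesis
      by blast
  qed
  have unbounded: "D (k - 1) \<noteq> 0" if unb: "\<forall>n. \<exists>m>n. measure N {\<omega> \<in> space N. T0 \<omega> = m} > 0" for k
  proof (rule D_nonzero)
    note [measurable] = base(2)
    obtain m where m: "m > k" "measure N {\<omega> \<in> space N. T0 \<omega> = m} > 0"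
      using unb by blast
    \<comment> \<open>A single atom beyond \<open>k\<close> already gives the tail positive
      mass.\<close>
    have "measure N {\<omega> \<in> space N. T0 \<omega> = m} \<le> measure N {\<omega> \<in> space N. k \<le> T0 \<omega>}"
      using m(1) by (intro N.finite_measure_mono) auto
    then show "0 < measure N {\<omega> \<in> space N. k \<le> T0 \<omega>}"
      using m(2) by linarith
  qed
  show ?thesis
  proof (intro conjI allI impI)
    fix k :: nat assume k: "2 \<le> k"
    show "derivs_in q k - (\<Union>j<k. derivs_in q j) = {k - 1}"
      using k q by (intro new_derivs_in) auto
    show "D (k - 1) \<noteq> 0" if "0 < measure N {\<omega> \<in> space N. k \<le> T0 \<omega>}"
      by (rule D_nonzero[OF that])
    show "D (k - 1) \<noteq> 0" if "\<forall>n. \<exists>m>n. measure N {\<omega> \<in> space N. T0 \<omega> = m} > 0"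
      by (rule unbounded[OF that])
    show "- (real k * s ^ (k - 1) / (p\<^sup>2 * q)) * D (k - 1) \<noteq> 0" if "D (k - 1) \<noteq> 0"
      using coeff[OF k] that by (simp only: mult_eq_0_iff simp_thms)
  qed (use integrable eta_eq remainder coeff in blast)+
qed

end
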